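(* Let $W\ge1$ be an integer and let $0\le\epsilon\le\frac14$. Any randomized Las Vegas algorithm that provides a $W\epsilon$-additive approximation for the Basic-Counting problem with window size $W$ requires at least $$\left\lfloor \max\left\{\log W,\ \frac{1}{2\epsilon+W^{-1}}\right\}\right\rfloor$$ bits of memory. Further, for any fixed $\delta\in(0,1/2)$, if in addition $\epsilon\ge\frac{1}{2W}$, any Monte Carlo algorithm that with probability at least $1-\delta$ approximates Basic-Counting within $W\epsilon$ error at any time instant requires $\Omega\left(\frac1\epsilon+\log W\right)$ bits of memory.
   Context: All logarithms are base 2. Basic-Counting: given a stream of bits arriving one at a time and a window size $W$, maintain $C^W$, the number of 1's among the last $W$ bits of the stream (if fewer than $W$ bits have arrived, among all bits so far). A deterministic algorithm using $m$ bits of memory has at most $2^m$ memory configurations, a fixed initial configuration, and a deterministic transition of configuration upon each arriving bit; when queried it outputs a real number determined by its current configuration. An algorithm is $\epsilon$-correct on an input stream $S$ if at every time instant while reading $S$ its query answer differs from $C^W$ by at most $W\epsilon$. A randomized algorithm is a probability distribution over deterministic algorithms, and its memory requirement is the expected number of memory bits of the drawn deterministic algorithm (in the sense of Yao's minimax principle). A Las Vegas algorithm is a randomized algorithm that is always $\epsilon$-correct, on every input. A Monte Carlo algorithm here is a randomized algorithm that, for every input stream, is $\epsilon$-correct on it with probability at least $1-\delta$. The $\Omega(\cdot)$ is for $W\to\infty$, uniformly over the allowed $\epsilon$, with the hidden constant allowed to depend on the fixed $\delta$ only. *)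

theory Defs
  imports "HOL-Probability.Probability"
begin

text \<open>
  Bit streams are finite lists, oldest bit first.  The window contains the last \<open>W\<close> bits, or
  all of them if fewer have arrived (truncated subtraction on \<^typ>\<open>nat\<close>).
\<close>

definition window_count :: "nat \<Rightarrow> bool list \<Rightarrow> nat" where
  "window_count W S = count_list (drop (length S - W) S) True"

text \<open>
  An algorithm using \<open>m\<close> bits has its memory configurations among the labels \<open>0, \<dots>, 2 ^ m - 1\<close>;
  not every label need be reachable.  The fields \<open>trans_conf\<close> and \<open>answer\<close> are irrelevant on larger
  labels.
\<close>

record det_alg =
  mem_bits :: nat
  init_conf :: nat
  trans_conf :: "nat \<Rightarrow> bool \<Rightarrow> nat"
  answer :: "nat \<Rightarrow> real"

definition wf_det_alg :: "det_alg \<Rightarrow> bool" where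
  "wf_det_alg A \<longleftrightarrow> init_conf A < 2 ^ mem_bits A \<and>
     (\<forall>q b. q < 2 ^ mem_bits A \<longrightarrow> trans_conf A q b < 2 ^ mem_bits A)"

definition conf_after :: "det_alg \<Rightarrow> bool list \<Rightarrow> nat" where
  "conf_after A S = foldl (trans_conf A) (init_conf A) S"

definition answer_after :: "det_alg \<Rightarrow> bool list \<Rightarrow> real" where
  "answer_after A S = answer A (conf_after A S)"

definition eps_correct :: "nat \<Rightarrow> real \<Rightarrow> det_alg \<Rightarrow> bool list \<Rightarrow> bool" where
  "eps_correct W \<epsilon> A S \<longleftrightarrow>
     (\<forall>t\<le>length S. \<bar>answer_after A (take t S) - real (window_count W (take t S))\<bar> \<le> real W * \<epsilon>)"

text \<open>
  A probability distribution over deterministic algorithms, not necessarily discrete.  Any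
  \<open>\<sigma>\<close>-algebra is allowed for which the number of memory bits and the answer after each finite
  stream are random variables; this makes expected memory and the probability of correctness
  meaningful.
\<close>

definition randomized_alg :: "det_alg measure \<Rightarrow> bool" where
  "randomized_alg M \<longleftrightarrow> prob_space M \<and> (\<forall>A\<in>space M. wf_det_alg A) \<and>
     mem_bits \<in> measurable M (count_space UNIV) \<and>
     (\<forall>S. (\<lambda>A. answer_after A S) \<in> borel_measurable M)"

lemma eps_correct_measurable:
  assumes "randomized_alg M"
  shows "{A \<in> space M. eps_correct W \<epsilon> A S} \<in> sets M"
proof -
  have [measurable]: "(\<lambda>A. answer_after A S') \<in> borel_measurable M" for S'
    using assms by (simp add: randomized_alg_def)
  show ?thesis
    unfolding eps_correct_def by measurable
qed

text \<open>The expectation is extended-valued, so it may be infinite.\<close>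

definition expected_memory :: "det_alg measure \<Rightarrow> ennreal" where
  "expected_memory M = (\<integral>\<^sup>+ A. of_nat (mem_bits A) \<partial>M)"

text \<open>
  ``Always correct'' disregards sets of algorithms drawn with probability zero; in particular it
  covers the case that every algorithm in \<open>space M\<close> is correct on every input.
\<close>

definition las_vegas :: "nat \<Rightarrow> real \<Rightarrow> det_alg measure \<Rightarrow> bool" where
  "las_vegas W \<epsilon> M \<longleftrightarrow> randomized_alg M \<and> (AE A in M. \<forall>S. eps_correct W \<epsilon> A S)"

text \<open>
  Quantifying over finite streams loses nothing: by continuity of measure, correctness with
  probability at least \<open>1 - \<delta>\<close> on all prefixes of an infinite stream is the same as correctness
  with probability at least \<open>1 - \<delta>\<close> on that infinite stream.
\<close>

definition monte_carlo :: "nat \<Rightarrow> real \<Rightarrow> real \<Rightarrow> det_alg measure \<Rightarrow> bool" where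
  "monte_carlo W \<epsilon> \<delta> M \<longleftrightarrow> randomized_alg M \<and>
     (\<forall>S. measure M {A \<in> space M. eps_correct W \<epsilon> A S} \<ge> 1 - \<delta>)"

end

theory Submission
  imports Defs
begin

text \<open>
  Both bounds count configurations.  Feeding zeros after \<open>W\<close> ones, an algorithm whose
  configuration repeats within the first \<open>W / 2\<close> zeros cycles forever, so one of its answers must
  serve both a count above \<open>W / 2\<close> and the count \<open>0\<close>, which is impossible for \<open>\<epsilon> \<le> 1 / 4\<close>.
  For the other bound, bits are encoded as constant blocks whose length \<open>B\<close> exceeds \<open>2 * W * \<epsilon>\<close>;
  if two encodings led to the same configuration, appending zeros until the last block in which
  they differ is the oldest one in the window would give counts that differ by \<open>B\<close> but equal answers.

  In either case a single continuation by zeros serves all pairs, so correctness on one stream per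
  codeword suffices.  For Monte Carlo algorithms the expected fraction of
  codewords handled correctly is at least \<open>1 - \<delta> > 1 / 2\<close>, and handling a quarter of the
  \<open>2 ^ n\<close> codewords already costs \<open>n - 2\<close> bits.
\<close>

section \<open>Runs of an algorithm and window counts\<close>

lemma conf_after_append: "conf_after A (S @ T) = foldl (trans_conf A) (conf_after A S) T"
  by (simp add: conf_after_def)

lemma conf_after_less:
  assumes "wf_det_alg A"
  shows "conf_after A S < 2 ^ mem_bits A"
proof (induction S rule: rev_induct)
  case Nil
  then show ?case using assms by (simp add: conf_after_def wf_det_alg_def)
next
  case (snoc b S)
  then show ?case using assms by (simp add: conf_after_append wf_det_alg_def)
qed

lemma eps_correct_prefix:
  assumes "eps_correct W \<epsilon> A (S @ T)"
  shows "\<bar>answer_after A S - real (window_count W S)\<bar> \<le> real W * \<epsilon>"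
proof -
  have "\<bar>answer_after A (take (length S) (S @ T)) - real (window_count W (take (length S) (S @ T)))\<bar>
      \<le> real W * \<epsilon>"
    using assms unfolding eps_correct_def by (metis length_append le_add1)
  then show ?thesis by simp
qed

lemma count_list_replicate: "count_list (replicate n x) y = (if x = y then n else 0)"
  by (induction n) auto

lemma window_count_append:
  assumes "length T = W"
  shows "window_count W (S @ T) = count_list T True"
  using assms by (simp add: window_count_def)

lemma window_count_ones_zeros:
  "window_count W (replicate W True @ replicate i False) = W - i"
  by (simp add: window_count_def count_list_replicate)

section \<open>Logarithmic bound from cycling on zeros\<close>

lemma mem_bits_window_size:
  assumes wf: "wf_det_alg A" and eps: "\<epsilon> \<le> 1 / 4"
    and correct: "eps_correct W \<epsilon> A (replicate W True @ replicate (W * W + W) False)"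
  shows "W < 2 ^ (mem_bits A + 1)"
proof (rule ccontr)
  assume "\<not> ?thesis"
  then have large: "2 * 2 ^ mem_bits A \<le> W" by simp
  define g where "g i = conf_after A (replicate W True @ replicate i False)" for i
  have g_add: "g (i + k) = foldl (trans_conf A) (g i) (replicate k False)" for i k
    by (simp add: g_def replicate_add conf_after_append)
  have "g ` {..2 ^ mem_bits A} \<subseteq> {..<2 ^ mem_bits A}"
    using conf_after_less[OF wf] by (auto simp: g_def)
  then have "card (g ` {..2 ^ mem_bits A}) \<le> 2 ^ mem_bits A"
    using card_mono[of "{..<2 ^ mem_bits A}"] by fastforce
  then have "\<not> inj_on g {..2 ^ mem_bits A}"
    by (intro pigeonhole) simp
  then obtain i j where ij: "i < j" "j \<le> 2 ^ mem_bits A" "g i = g j"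
    unfolding inj_on_def by (metis atMost_iff linorder_neqE_nat)
  define d where "d = j - i"
  have d: "0 < d" "g (i + d) = g i" using ij by (auto simp: d_def)
  have cycle: "g (i + k * d) = g i" for k
  proof (induction k)
    case (Suc k)
    have "g (i + Suc k * d) = foldl (trans_conf A) (g (i + k * d)) (replicate d False)"
      using g_add[of "i + k * d" d] by (simp add: algebra_simps)
    then show ?case using Suc d(2) by (simp add: g_add)
  qed simp
  have bound: "\<bar>answer A (g k) - real (W - k)\<bar> \<le> real W * \<epsilon>" if "k \<le> W * W + W" for k
  proof -
    have "replicate (W * W + W) False = replicate k False @ replicate (W * W + W - k) False"
      using that by (simp flip: replicate_add)
    then show ?thesis
      using eps_correct_prefix[of W \<epsilon> A "replicate W True @ replicate k False"] correct
      by (simp add: window_count_ones_zeros answer_after_def g_def)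
  qed
  \<comment> \<open>After \<open>W\<close> rounds of the cycle at least \<open>W\<close> zeros have
    arrived, because \<open>d\<close> is positive, so the true count is 0. This moment lies within
    \<open>W * W + W\<close> zeros, which explains the length of the test stream.\<close>
  have "d \<le> W" "i \<le> W" using ij large by (auto simp: d_def)
  then have "i + W * d \<le> W * W + W" by (simp add: add.commute add_mono)
  moreover have "W \<le> i + W * d" using d(1) by (simp add: trans_le_add2)
  ultimately have "\<bar>answer A (g i)\<bar> \<le> real W * \<epsilon>"
    using bound[of "i + W * d"] by (simp add: cycle)
  moreover have "\<bar>answer A (g i) - real (W - i)\<bar> \<le> real W * \<epsilon>"
    using \<open>i \<le> W\<close> by (intro bound) simp
  moreover have "real W * \<epsilon> \<le> real W * (1 / 4)" using eps by (intro mult_left_mono) auto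
  \<comment> \<open>Strict because \<open>i < j\<close> and \<open>j\<close> is at most
    \<open>W / 2\<close>: the counts \<open>W - i\<close> and 0 are more than \<open>W / 2\<close>
    apart, while one answer would be within \<open>W / 4\<close> of both.\<close>
  moreover have "2 * real i < real W" using ij large by linarith
  ultimately show False using \<open>i \<le> W\<close> by (simp add: of_nat_diff)
qed

text \<open>Using only the first half of the zeros loses a factor 2 in \<open>W\<close>, that is
  less than one full bit, which the floor absorbs.\<close>

lemma floor_log_le_mem_bits:
  assumes "wf_det_alg A" "\<epsilon> \<le> 1 / 4" "1 \<le> W"
    and "eps_correct W \<epsilon> A (replicate W True @ replicate (W * W + W) False)"
  shows "\<lfloor>log 2 (real W)\<rfloor> \<le> int (mem_bits A)"
proof -
  have "real W < 2 ^ (mem_bits A + 1)"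
    using mem_bits_window_size[OF assms(1,2,4)]
    by (metis of_nat_less_iff of_nat_numeral of_nat_power)
  then have "log 2 (real W) < real (mem_bits A + 1)"
    using assms(3) by (simp add: log_less_iff powr_realpow powr_add)
  then show ?thesis by (simp add: floor_le_iff)
qed

section \<open>Block encodings and the bound from counting codewords\<close>

definition block_code :: "nat \<Rightarrow> bool list \<Rightarrow> bool list" where
  "block_code B x = concat (map (replicate B) x)"

lemma block_code_append [simp]: "block_code B (x @ y) = block_code B x @ block_code B y"
  by (simp add: block_code_def)

lemma block_code_Cons [simp]: "block_code B (a # x) = replicate B a @ block_code B x"
  by (simp add: block_code_def)

lemma length_block_code [simp]: "length (block_code B x) = length x * B"
  by (induction x) (auto simp: block_code_def)

text \<open>The choice of \<open>k\<close> pushes the blocks of \<open>p\<close> out of the window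
  and leaves the block of \<open>a\<close> as its oldest part. By \<open>fits\<close> the
  subtraction in \<open>k\<close> is not truncated, and \<open>k \<le> W\<close> keeps this moment
  inside the tested stream.\<close>

lemma eps_correct_block_code:
  assumes fits: "length (p @ a # s) * B \<le> W"
    and correct: "eps_correct W \<epsilon> A (block_code B (p @ a # s) @ replicate W False)"
  defines "k \<equiv> W - Suc (length s) * B"
  shows "\<bar>answer_after A (block_code B (p @ a # s) @ replicate k False)
      - real ((if a then B else 0) + count_list (block_code B s) True)\<bar> \<le> real W * \<epsilon>"
proof -
  have k: "k \<le> W" "Suc (length s) * B + k = W"
    using fits by (auto simp: k_def algebra_simps)
  have "replicate W False = replicate k False @ replicate (W - k) False"
    using k(1) by (simp flip: replicate_add)
  then have "\<bar>answer_after A (block_code B (p @ a # s) @ replicate k False)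
      - real (window_count W (block_code B (p @ a # s) @ replicate k False))\<bar> \<le> real W * \<epsilon>"
    using correct by (intro eps_correct_prefix[where T = "replicate (W - k) False"]) simp
  moreover have "window_count W (block_code B p @ replicate B a @ block_code B s @ replicate k False)
      = (if a then B else 0) + count_list (block_code B s) True"
    using k(2) by (subst window_count_append) (auto simp: count_list_replicate)
  ultimately show ?thesis by simp
qed

lemma inj_on_conf_after_block_code:
  assumes gap: "2 * (real W * \<epsilon>) < real B" and fits: "n * B \<le> W"
  shows "inj_on (\<lambda>x. conf_after A (block_code B x))
    {x. length x = n \<and> eps_correct W \<epsilon> A (block_code B x @ replicate W False)}"
proof (rule inj_onI, rule ccontr)
  fix x y
  assume x: "x \<in> {x. length x = n \<and> eps_correct W \<epsilon> A (block_code B x @ replicate W False)}"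
    and y: "y \<in> {x. length x = n \<and> eps_correct W \<epsilon> A (block_code B x @ replicate W False)}"
    and same: "conf_after A (block_code B x) = conf_after A (block_code B y)" and "x \<noteq> y"
  \<comment> \<open>Reversal turns the first difference into the last one. The words then share the
    tail \<open>rev s\<close>, so the same \<open>k\<close> isolates the differing block in
    both.\<close>
  have "rev x \<noteq> rev y" "length (rev x) = length (rev y)" using x y \<open>x \<noteq> y\<close> by auto
  then obtain s a p b q where "a \<noteq> b" "rev x = s @ [a] @ p" "rev y = s @ [b] @ q"
    using same_length_different[of "rev x" "rev y"] by metis
  then have x_eq: "x = rev p @ a # rev s" and y_eq: "y = rev q @ b # rev s"
    by (simp_all add: rev_swap)
  define k where "k = W - Suc (length s) * B"
  have "\<bar>answer_after A (block_code B x @ replicate k False)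
      - real ((if a then B else 0) + count_list (block_code B (rev s)) True)\<bar> \<le> real W * \<epsilon>"
    using x eps_correct_block_code[of "rev p" a "rev s" B W \<epsilon> A] fits
    unfolding x_eq k_def by simp
  moreover have "\<bar>answer_after A (block_code B y @ replicate k False)
      - real ((if b then B else 0) + count_list (block_code B (rev s)) True)\<bar> \<le> real W * \<epsilon>"
    using y eps_correct_block_code[of "rev q" b "rev s" B W \<epsilon> A] fits
    unfolding y_eq k_def by simp
  moreover have "answer_after A (block_code B x @ replicate k False)
      = answer_after A (block_code B y @ replicate k False)"
    by (simp add: answer_after_def conf_after_append same)
  ultimately show False using \<open>a \<noteq> b\<close> gap by (cases a; cases b) auto
qed

text \<open>Only codewords that \<open>A\<close> itself handles correctly are counted, so the bound
  also serves algorithms that fail on some inputs.\<close>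

lemma card_correct_codewords_le:
  assumes "wf_det_alg A" "2 * (real W * \<epsilon>) < real B" "n * B \<le> W"
  shows "card {x. length x = n \<and> eps_correct W \<epsilon> A (block_code B x @ replicate W False)}
    \<le> 2 ^ mem_bits A"
  using card_inj_on_le[OF inj_on_conf_after_block_code[OF assms(2,3), of A], of "{..<2 ^ mem_bits A}"]
    conf_after_less[OF assms(1)]
  by auto

lemma finite_bool_lists: "finite {x :: bool list. length x = n}"
  using finite_lists_length_eq[of "UNIV :: bool set" n] by simp

lemma card_bool_lists: "card {x :: bool list. length x = n} = 2 ^ n"
  using card_lists_length_eq[of "UNIV :: bool set" n] by simp

text \<open>\<open>B\<close> is the least integer above \<open>2 * W * \<epsilon>\<close>, hence at
  most \<open>2 * W * \<epsilon> + 1\<close>. Dividing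
  \<open>n * (2 * W * \<epsilon> + 1) \<le> W\<close> by \<open>W\<close> gives exactly the
  condition that defines \<open>n\<close>.\<close>

lemma block_parameters:
  fixes W :: nat and \<epsilon> :: real
  assumes "1 \<le> W" "0 \<le> \<epsilon>"
  defines "n \<equiv> nat \<lfloor>1 / (2 * \<epsilon> + inverse (real W))\<rfloor>" and "B \<equiv> nat \<lfloor>2 * (real W * \<epsilon>)\<rfloor> + 1"
  shows "2 * (real W * \<epsilon>) < real B" "n * B \<le> W"
proof -
  have B: "real B = of_int \<lfloor>2 * (real W * \<epsilon>)\<rfloor> + 1" using assms by (simp add: B_def)
  then show "2 * (real W * \<epsilon>) < real B" by linarith
  have pos: "0 < 2 * \<epsilon> + inverse (real W)" using assms by (simp add: add_nonneg_pos)
  have "real n \<le> 1 / (2 * \<epsilon> + inverse (real W))"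
    using pos by (simp add: n_def)
  then have "real n * (2 * \<epsilon> + inverse (real W)) \<le> 1"
    using pos by (simp add: pos_le_divide_eq)
  then have "real n * (2 * \<epsilon> + inverse (real W)) * real W \<le> 1 * real W"
    by (rule mult_right_mono) simp
  moreover have "(2 * \<epsilon> + inverse (real W)) * real W = 2 * (real W * \<epsilon>) + 1"
    using assms(1) by (simp add: distrib_right)
  ultimately have "real n * (2 * (real W * \<epsilon>) + 1) \<le> real W" by (simp only: mult.assoc mult_1)
  moreover have "real n * real B \<le> real n * (2 * (real W * \<epsilon>) + 1)"
    unfolding B by (intro mult_left_mono) auto
  ultimately show "n * B \<le> W" by (metis of_nat_le_iff of_nat_mult order_trans)
qed

section \<open>The Las Vegas bound\<close>

lemma deterministic_memory:
  assumes wf: "wf_det_alg A" and W: "1 \<le> W" and eps: "0 \<le> \<epsilon>" "\<epsilon> \<le> 1 / 4"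
    and correct: "\<And>S. eps_correct W \<epsilon> A S"
  shows "\<lfloor>max (log 2 (real W)) (1 / (2 * \<epsilon> + inverse (real W)))\<rfloor> \<le> int (mem_bits A)"
proof -
  define n where "n = nat \<lfloor>1 / (2 * \<epsilon> + inverse (real W))\<rfloor>"
  have "(2::nat) ^ n \<le> 2 ^ mem_bits A"
    using card_correct_codewords_le[OF wf block_parameters[OF W eps(1)]]
    by (simp add: correct card_bool_lists n_def)
  then have "\<lfloor>1 / (2 * \<epsilon> + inverse (real W))\<rfloor> \<le> int (mem_bits A)"
    by (simp add: n_def)
  moreover have "\<lfloor>log 2 (real W)\<rfloor> \<le> int (mem_bits A)"
    using floor_log_le_mem_bits wf eps W correct by blast
  ultimately show ?thesis by (simp add: floor_le_iff)
qed

lemma las_vegas_memory: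
  assumes "1 \<le> W" "0 \<le> \<epsilon>" "\<epsilon> \<le> 1 / 4" and M: "las_vegas W \<epsilon> M"
  shows "ennreal (of_int \<lfloor>max (log 2 (real W)) (1 / (2 * \<epsilon> + inverse (real W)))\<rfloor>)
    \<le> expected_memory M"
proof -
  define k where "k = \<lfloor>max (log 2 (real W)) (1 / (2 * \<epsilon> + inverse (real W)))\<rfloor>"
  have rand: "randomized_alg M" and ae: "AE A in M. \<forall>S. eps_correct W \<epsilon> A S"
    using M by (auto simp: las_vegas_def)
  interpret prob_space M using rand by (simp add: randomized_alg_def)
  have "AE A in M. ennreal (of_int k) \<le> of_nat (mem_bits A)"
    using ae AE_space
  proof eventually_elim
    case (elim A)
    have "k \<le> int (mem_bits A)"
      unfolding k_def using elim rand assms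
      by (intro deterministic_memory) (auto simp: randomized_alg_def)
    then have "(of_int k :: real) \<le> real (mem_bits A)" by linarith
    then show ?case by (simp add: ennreal_leI flip: ennreal_of_nat_eq_real_of_nat)
  qed
  then have "(\<integral>\<^sup>+ A. ennreal (of_int k) \<partial>M) \<le> expected_memory M"
    unfolding expected_memory_def by (rule nn_integral_mono_AE)
  then show ?thesis by (simp add: k_def emeasure_space_1)
qed

section \<open>The Monte Carlo bounds\<close>

lemma integral_le_expected_memory:
  assumes f: "integrable M f" and le: "\<And>A. A \<in> space M \<Longrightarrow> f A \<le> real (mem_bits A)"
  shows "ennreal (\<integral>A. f A \<partial>M) \<le> expected_memory M"
proof -
  \<comment> \<open>\<open>f\<close> may be negative; truncating it at 0 keeps it below the memory
    and allows the passage to the nonnegative integral.\<close>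
  have g: "integrable M (\<lambda>A. max 0 (f A))" using f by simp
  have "ennreal (\<integral>A. f A \<partial>M) \<le> ennreal (\<integral>A. max 0 (f A) \<partial>M)"
    using f g by (intro ennreal_leI integral_mono) auto
  also have "\<dots> = (\<integral>\<^sup>+ A. ennreal (max 0 (f A)) \<partial>M)"
    using g by (intro nn_integral_eq_integral[symmetric]) auto
  also have "\<dots> \<le> expected_memory M"
    unfolding expected_memory_def using le
    by (intro nn_integral_mono) (auto simp: ennreal_of_nat_eq_real_of_nat intro!: ennreal_leI)
  finally show ?thesis .
qed

lemma monte_carlo_prob:
  assumes "monte_carlo W \<epsilon> \<delta> M" "\<delta> < 1 / 2"
  shows "1 / 2 \<le> measure M {A \<in> space M. eps_correct W \<epsilon> A S}"
proof -
  have "1 - \<delta> \<le> measure M {A \<in> space M. eps_correct W \<epsilon> A S}"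
    using assms(1) by (simp add: monte_carlo_def)
  then show ?thesis using assms(2) by linarith
qed

text \<open>One fixed stream already forces the logarithmic cost on every algorithm correct on it,
  and such an algorithm is drawn with probability at least 1/2.\<close>

lemma monte_carlo_log_memory:
  assumes "1 \<le> W" "\<epsilon> \<le> 1 / 4" "\<delta> < 1 / 2" and M: "monte_carlo W \<epsilon> \<delta> M"
  shows "ennreal (of_int \<lfloor>log 2 (real W)\<rfloor> / 2) \<le> expected_memory M"
proof -
  have rand: "randomized_alg M" using M by (simp add: monte_carlo_def)
  interpret prob_space M using rand by (simp add: randomized_alg_def)
  define k where "k = \<lfloor>log 2 (real W)\<rfloor>"
  define C where "C = {A \<in> space M. eps_correct W \<epsilon> A (replicate W True @ replicate (W * W + W) False)}"
  have C: "C \<in> sets M" unfolding C_def using rand by (rule eps_correct_measurable)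
  have "1 / 2 \<le> prob C"
    unfolding C_def using M assms(3) by (rule monte_carlo_prob)
  moreover have "0 \<le> k" using assms(1) by (simp add: k_def)
  ultimately have "of_int k / 2 \<le> of_int k * prob C"
    using mult_left_mono[of "1 / 2" "prob C" "of_int k"] by simp
  also have "\<dots> = (\<integral>A. of_int k * indicator C A \<partial>M)" using C by simp
  finally have "ennreal (of_int k / 2) \<le> ennreal (\<integral>A. of_int k * indicator C A \<partial>M)"
    by (rule ennreal_leI)
  also have "\<dots> \<le> expected_memory M"
  proof (rule integral_le_expected_memory)
    show "integrable M (\<lambda>A. of_int k * indicator C A :: real)"
      using C by (simp add: less_top[symmetric])
    fix A assume A: "A \<in> space M"
    have "k \<le> int (mem_bits A)" if "A \<in> C"
      unfolding k_def using that A rand assms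
      by (intro floor_log_le_mem_bits) (auto simp: C_def randomized_alg_def)
    then have "real_of_int k \<le> real (mem_bits A)" if "A \<in> C"
      using that by fastforce
    then show "of_int k * indicator C A \<le> real (mem_bits A)"
      by (auto simp: indicator_def)
  qed
  finally show ?thesis by (simp add: k_def)
qed

text \<open>If \<open>F A\<close> is the fraction of codewords handled by \<open>A\<close>, the
  affine function \<open>(n - 2) * (F A - 1 / 4)\<close> stays below the memory of \<open>A\<close>:
  it is nonpositive up to a quarter and at most \<open>n - 2\<close> beyond. Being affine, it can be
  integrated from the mean of \<open>F\<close> alone, which is at least 1/2.\<close>

lemma monte_carlo_block_memory:
  assumes gap: "2 * (real W * \<epsilon>) < real B" and fits: "n * B \<le> W" and "\<delta> < 1 / 2"
    and M: "monte_carlo W \<epsilon> \<delta> M"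
  shows "ennreal ((real n - 2) / 4) \<le> expected_memory M"
proof (cases "n \<le> 2")
  case True
  \<comment> \<open>The left side is nonpositive, and \<open>ennreal\<close> sends it to 0.\<close>
  then show ?thesis by (simp add: ennreal_neg)
next
  case False
  have rand: "randomized_alg M" using M by (simp add: monte_carlo_def)
  interpret prob_space M using rand by (simp add: randomized_alg_def)
  define X where "X = {x :: bool list. length x = n}"
  have X: "finite X" "card X = 2 ^ n"
    by (simp_all add: X_def finite_bool_lists card_bool_lists)
  define C where "C x = {A \<in> space M. eps_correct W \<epsilon> A (block_code B x @ replicate W False)}" for x
  have C: "C x \<in> sets M" for x unfolding C_def using rand by (rule eps_correct_measurable)
  have prob_C: "1 / 2 \<le> prob (C x)" for x
    unfolding C_def using M assms(3) by (rule monte_carlo_prob)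
  define F where "F A = (\<Sum>x\<in>X. indicator (C x) A) / (2 ^ n :: real)" for A
  have indicator_C: "integrable M (indicator (C x) :: det_alg \<Rightarrow> real)" for x
    using C by (simp add: less_top[symmetric])
  then have F: "integrable M F" unfolding F_def by (simp add: integrable_sum)
  have "1 / 2 \<le> (\<Sum>x\<in>X. prob (C x)) / 2 ^ n"
    using sum_bounded_below[of X "1 / 2" "\<lambda>x. prob (C x)"] X(2) prob_C by (simp add: field_simps)
  also have "\<dots> = (\<integral>A. F A \<partial>M)" using C indicator_C by (simp add: F_def)
  finally have "(real n - 2) * (1 / 2 - 1 / 4) \<le> (real n - 2) * ((\<integral>A. F A \<partial>M) - 1 / 4)"
    using False by (intro mult_left_mono) auto
  also have "\<dots> = (\<integral>A. (real n - 2) * (F A - 1 / 4) \<partial>M)"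
    using F by (simp add: prob_space)
  finally have "ennreal ((real n - 2) / 4) \<le> ennreal (\<integral>A. (real n - 2) * (F A - 1 / 4) \<partial>M)"
    by (intro ennreal_leI) simp
  also have "\<dots> \<le> expected_memory M"
  proof (rule integral_le_expected_memory)
    show "integrable M (\<lambda>A. (real n - 2) * (F A - 1 / 4))" using F by simp
    fix A assume A: "A \<in> space M"
    define Y where "Y = {x. length x = n \<and> eps_correct W \<epsilon> A (block_code B x @ replicate W False)}"
    have "Y \<subseteq> X" by (auto simp: X_def Y_def)
    have "(\<Sum>x\<in>X. indicator (C x) A) = (\<Sum>x\<in>X. if x \<in> Y then 1 else (0::real))"
      using A by (intro sum.cong) (auto simp: X_def Y_def C_def)
    also have "\<dots> = real (card Y)"
      using X(1) \<open>Y \<subseteq> X\<close> by (simp add: sum.If_cases Int_absorb1)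
    finally have F_eq: "F A = real (card Y) / 2 ^ n" by (simp add: F_def)
    have "card Y \<le> 2 ^ n" using card_mono[OF X(1) \<open>Y \<subseteq> X\<close>] X(2) by simp
    then have "F A \<le> 1" using F_eq by (simp add: of_nat_le_of_nat_power_cancel_iff)
    show "(real n - 2) * (F A - 1 / 4) \<le> real (mem_bits A)"
    proof (cases "F A \<le> 1 / 4")
      case True
      then have "(real n - 2) * (F A - 1 / 4) \<le> 0"
        using False by (simp add: mult_nonneg_nonpos)
      then show ?thesis by linarith
    next
      case large: False
      have "card Y \<le> 2 ^ mem_bits A"
        unfolding Y_def using rand A gap fits
        by (intro card_correct_codewords_le) (auto simp: randomized_alg_def)
      then have "real (card Y) \<le> 2 ^ mem_bits A"
        by (metis of_nat_le_iff of_nat_numeral of_nat_power)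
      moreover have "2 ^ n < 4 * real (card Y)" using large F_eq by (simp add: field_simps)
      ultimately have "(2::real) ^ n < 4 * 2 ^ mem_bits A" by linarith
      then have "(2::real) ^ n < 2 ^ (mem_bits A + 2)" by simp
      then have "n < mem_bits A + 2" by (rule power_less_imp_less_exp[rotated]) simp
      then have "real n - 2 \<le> real (mem_bits A)" by linarith
      moreover have "(real n - 2) * (F A - 1 / 4) \<le> real n - 2"
        using False \<open>F A \<le> 1\<close> by (intro mult_left_le) auto
      ultimately show ?thesis by linarith
    qed
  qed
  finally show ?thesis .
qed

lemma monte_carlo_memory:
  assumes W: "1024 \<le> W" and eps: "1 / (2 * real W) \<le> \<epsilon>" "\<epsilon> \<le> 1 / 4" and "\<delta> < 1 / 2"
    and M: "monte_carlo W \<epsilon> \<delta> M"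
  shows "ennreal (1 / 32 * (1 / \<epsilon> + log 2 (real W))) \<le> expected_memory M"
proof -
  define n where "n = nat \<lfloor>1 / (2 * \<epsilon> + inverse (real W))\<rfloor>"
  define a b where "a = of_int \<lfloor>log 2 (real W)\<rfloor> / (2::real)" and "b = (real n - 2) / 4"
  have pos: "0 < \<epsilon>" using W by (intro less_le_trans[OF _ eps(1)]) simp
  \<comment> \<open>The lower bound on \<epsilon> makes the denominator at most
    \<open>4 * \<epsilon>\<close>, so \<open>n\<close> is of order
    \<open>1 / \<epsilon>\<close>.\<close>
  have "inverse (real W) \<le> 2 * \<epsilon>" using eps(1) W by (simp add: field_simps)
  then have "1 / (4 * \<epsilon>) \<le> 1 / (2 * \<epsilon> + inverse (real W))"
    using pos W by (intro divide_left_mono) (auto intro!: mult_pos_pos add_pos_pos)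
  also have "\<dots> < real n + 1" unfolding n_def by linarith
  finally have b: "1 / \<epsilon> / 16 - 3 / 4 \<le> b" by (simp add: b_def field_simps)
  have a: "log 2 (real W) / 2 - 1 / 2 \<le> a" unfolding a_def by linarith
  \<comment> \<open>The average of \<open>a\<close> and \<open>b\<close> is at least
    \<open>1 / (32 * \<epsilon>) + log 2 W / 4 - 5 / 8\<close>. For such \<open>W\<close> the
    surplus of \<open>log 2 W / 4\<close> over \<open>log 2 W / 32\<close> outweighs the loss of 5/8
    from rounding and from the \<open>- 2\<close> in \<open>b\<close>.\<close>
  have "10 \<le> log 2 (real W)" using W by (simp add: le_log_iff)
  then have "1 / 32 * (1 / \<epsilon> + log 2 (real W)) \<le> (a + b) / 2"
    using a b by (simp add: field_simps)
  also have "\<dots> \<le> max a b" by simp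
  finally have "1 / 32 * (1 / \<epsilon> + log 2 (real W)) \<le> max a b" .
  then have "ennreal (1 / 32 * (1 / \<epsilon> + log 2 (real W))) \<le> ennreal (max a b)"
    by (rule ennreal_leI)
  also have "\<dots> \<le> expected_memory M"
  proof -
    have "ennreal a \<le> expected_memory M"
      using W eps(2) assms(4) M unfolding a_def by (intro monte_carlo_log_memory) auto
    moreover have "ennreal b \<le> expected_memory M"
      unfolding b_def n_def using W pos assms(4) M
      by (intro monte_carlo_block_memory[OF block_parameters]) auto
    ultimately show ?thesis by (simp add: max_def)
  qed
  finally show ?thesis .
qed

theorem theorem6:
  shows "(\<forall>W::nat. \<forall>\<epsilon>::real. \<forall>M::det_alg measure.
            1 \<le> W \<longrightarrow> 0 \<le> \<epsilon> \<longrightarrow> \<epsilon> \<le> 1 / 4 \<longrightarrow> las_vegas W \<epsilon> M \<longrightarrow>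
            ennreal (of_int \<lfloor>max (log 2 (real W)) (1 / (2 * \<epsilon> + inverse (real W)))\<rfloor>)
              \<le> expected_memory M)
       \<and> (\<forall>\<delta>::real. 0 < \<delta> \<longrightarrow> \<delta> < 1 / 2 \<longrightarrow>
            (\<exists>c::real. c > 0 \<and>
              (\<forall>\<^sub>F W::nat in sequentially. \<forall>\<epsilon>::real. \<forall>M::det_alg measure.
                 1 / (2 * real W) \<le> \<epsilon> \<longrightarrow> \<epsilon> \<le> 1 / 4 \<longrightarrow> monte_carlo W \<epsilon> \<delta> M \<longrightarrow>
                 ennreal (c * (1 / \<epsilon> + log 2 (real W))) \<le> expected_memory M)))"
proof (intro conjI allI impI)
  fix \<delta> :: real
  assume "\<delta> < 1 / 2"
  then have "1024 \<le> W \<Longrightarrow> \<forall>\<epsilon> M. 1 / (2 * real W) \<le> \<epsilon> \<longrightarrow> \<epsilon> \<le> 1 / 4 \<longrightarrow>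
      monte_carlo W \<epsilon> \<delta> M \<longrightarrow> ennreal (1 / 32 * (1 / \<epsilon> + log 2 (real W))) \<le> expected_memory M" for W
    using monte_carlo_memory by blast
  then show "\<exists>c::real. c > 0 \<and>
              (\<forall>\<^sub>F W::nat in sequentially. \<forall>\<epsilon>::real. \<forall>M::det_alg measure.
                 1 / (2 * real W) \<le> \<epsilon> \<longrightarrow> \<epsilon> \<le> 1 / 4 \<longrightarrow> monte_carlo W \<epsilon> \<delta> M \<longrightarrow>
                 ennreal (c * (1 / \<epsilon> + log 2 (real W))) \<le> expected_memory M)"
    \<comment> \<open>The same constant works for every \<delta> below 1/2, since \<delta> enters
      only through the success probability of at least 1/2.\<close>
    by (intro exI[of _ "1 / 32"] conjI eventually_sequentiallyI[of 1024]) simp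
qed (rule las_vegas_memory)

end
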